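(* Let $\mathbb{K}$ be a field. Let $f$ be a power series with coefficients in $\mathbb{K}$, with $f(0)=0$, such that $q:=\operatorname{mult}(f)-1$ satisfies $1\le q<\infty$, and let $\ell$ be the smallest nonnegative integer satisfying $\ell=q$ in $\mathbb{K}$. Then for every power series $h$ with coefficients in $\mathbb{K}$ such that $h(0)=0$ and $h'(0)\neq 0$, the power series $\widehat{f}:=h^{-1}\circ f\circ h$ satisfies $$\iota_1(\widehat{f})=h'(0)^{\ell-q}\,\iota_1(f).$$
   Context: For a power series $f\in\mathbb{K}[[z]]$ with $f(0)=0$, the multiplicity $\operatorname{mult}(f)$ is the order of vanishing at $0$ of $f(z)-z$, i.e. the integer $m$ with $f(z)-z=a_mz^m+\cdots$, $a_m\neq0$ (and $\operatorname{mult}(f)=\infty$ if $f(z)=z$). If $q:=\operatorname{mult}(f)-1\ge 1$ is finite and $\ell$ is the smallest nonnegative integer with $\ell=q$ in $\mathbb{K}$ (so $\ell=q$ in characteristic $0$, and $\ell$ is the remainder of $q$ modulo $p$ in characteristic $p>0$), the second residue fixed point index $\iota_1(f)$ is the coefficient of $\frac1z$ in the Laurent series expansion about $0$ of $\dfrac{z^{q-\ell}}{z-f(z)}$. Here $h^{-1}$ denotes the inverse of $h$ under composition. *)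

theory Defs
  imports
    "HOL-Computational_Algebra.Formal_Laurent_Series"
    "HOL-Library.Extended_Nat"
begin

definition fps_fixpoint_mult :: "'a::field fps \<Rightarrow> enat" where
  "fps_fixpoint_mult f = (if f = fps_X then \<infinity> else enat (subdegree (f - fps_X)))"

(* Meaningful only for f with constant term 0 and 1 <= q < \<infinity>.
   Since l <= q, the natural-number subtraction q - l is exact. *)
definition second_residue_index :: "'a::field fps \<Rightarrow> 'a" where
  "second_residue_index f =
     (let q = the_enat (fps_fixpoint_mult f - 1);
          l = (LEAST n. of_nat n = (of_nat q :: 'a))
      in fls_residue (fls_X ^ (q - l) / (fls_X - fps_to_fls f)))"

end

theory Submission
  imports Defs "HOL-Number_Theory.Cong"
begin

text \<open>
  Write \<open>D = X - f\<close> and \<open>e = X - h\<^sup>-\<^sup>1 \<circ> f \<circ> h\<close> for the displacements of the two conjugate series,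
  \<open>c = h'(0)\<close> and \<open>N = q - \<ell>\<close>, so that the indices are the residues of \<open>X\<^sup>N / D\<close> and \<open>X\<^sup>N / e\<close>.
  Three comparisons connect them.

  Residues are invariant under a change of variables: the residue of \<open>X\<^sup>N / D\<close> is that
  of \<open>h\<^sup>N h' / (D \<circ> h)\<close> (\<open>residue_change_of_variables\<close>).

  In characteristic \<open>p > 0\<close> the number \<open>N\<close> is a multiple of \<open>p\<close>. By the Frobenius identity \<open>h\<^sup>N\<close>
  therefore agrees with \<open>c\<^sup>N X\<^sup>N\<close> up to terms of order \<open>N + p > q\<close>, and \<open>D \<circ> h\<close> has order
  \<open>q + 1\<close>. Hence \<open>h\<^sup>N\<close> can be replaced by \<open>c\<^sup>N X\<^sup>N\<close> in the last residue
  (\<open>power_diff_linear_part_dvd\<close>). In characteristic 0 one has \<open>N = 0\<close>, and nothing has to be replaced.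

  Conjugacy says \<open>f \<circ> h = h \<circ> (X - e)\<close>. Expanding the right-hand side to first order in \<open>e\<close> gives
  \<open>D \<circ> h = h' e + O(e\<^sup>2)\<close>, so \<open>X\<^sup>N h' / (D \<circ> h)\<close> and \<open>X\<^sup>N / e\<close> differ by a power series
  (\<open>residue_conjugate_displacement\<close>).

  Together, the index of \<open>f\<close> is \<open>c\<^sup>N\<close> times the index of its conjugate.

  The delicate point is the change of variables. Its core is that \<open>h' / h\<^sup>n\<close> has residue 0 for
  \<open>n \<ge> 2\<close>. In characteristic 0 this holds because the quotient is a multiple of the derivative
  of \<open>h\<^bsup>1-n\<^esup>\<close>, but that argument divides by \<open>n - 1\<close>, which may vanish in the field. Instead the claim is
  turned into an identity between coefficients of powers of \<open>u = X / h\<close>, which is proved over any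
  commutative ring by a cyclic symmetry argument on lists (\<open>fps_nth_power_diagonal\<close>).
\<close>

section \<open>A division-free identity for diagonal coefficients of powers\<close>

text \<open>
  For a list of length \<open>n\<close> with sum \<open>n\<close>, view the entries minus 1 as the steps of a closed walk;
  this is the maximal height of the walk. It serves as a potential for the rotation of lists.
\<close>
definition max_excess :: "nat list \<Rightarrow> int" where
  "max_excess xs = (MAX i\<in>{1..length xs}. int (sum_list (take i xs)) - int i)"

text \<open>
  Rotating the list moves the starting point of the closed walk behind its first step.
  This lowers the whole set of visited heights, hence its maximum, by the size of that step.
\<close>
lemma max_excess_rotate1:
  assumes "sum_list (x # xs) = length (x # xs)"
  shows "int x - 1 = max_excess (x # xs) - max_excess (rotate1 (x # xs))"
proof -
  let ?n = "length (x # xs)"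
  let ?e = "\<lambda>ys i. int (sum_list (take i ys)) - int i"
  \<comment> \<open>The full rotated walk ends at height 0, which is the height of the original walk after its
    first step, reduced by that step. Hence the index \<open>1\<close> instead of \<open>Suc i\<close> at the end.\<close>
  have rot: "?e (xs @ [x]) i = ?e (x # xs) (if i = ?n then 1 else Suc i) - (int x - 1)"
    if "i \<in> {1..?n}" for i
    using that assms by (auto simp: le_Suc_eq)
  have perm: "(\<lambda>i. if i = ?n then 1 else Suc i) ` {1..?n} = {1..?n}"
  proof (intro equalityI subsetI)
    fix j assume j: "j \<in> {1..?n}"
    show "j \<in> (\<lambda>i. if i = ?n then 1 else Suc i) ` {1..?n}"
      by (rule image_eqI[of _ _ "if j = 1 then ?n else j - 1"]) (use j in auto)
  qed auto
  have "max_excess (xs @ [x]) =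
      Max ((\<lambda>i. ?e (x # xs) (if i = ?n then 1 else Suc i) - (int x - 1)) ` {1..?n})"
    unfolding max_excess_def using rot by (intro arg_cong[of _ _ Max] image_cong) auto
  also have "(\<lambda>i. ?e (x # xs) (if i = ?n then 1 else Suc i) - (int x - 1)) ` {1..?n} =
      (\<lambda>t. t - (int x - 1)) ` ?e (x # xs) ` ((\<lambda>i. if i = ?n then 1 else Suc i) ` {1..?n})"
    by (simp only: image_image)
  also have "Max \<dots> = max_excess (x # xs) - (int x - 1)"
    unfolding perm max_excess_def
    by (subst mono_Max_commute[of "\<lambda>t. t - (int x - 1)", symmetric]) (auto simp: mono_def)
  finally show ?thesis by simp
qed

lemma bij_betw_rotate1_natpermute: "bij_betw rotate1 (natpermute n k) (natpermute n k)"
proof -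
  have inj: "inj_on rotate1 (natpermute n k)"
  proof (rule inj_onI)
    fix xs ys :: "nat list" assume "rotate1 xs = rotate1 ys"
    then show "xs = ys" by (cases xs; cases ys) auto
  qed
  moreover have "rotate1 ` natpermute n k \<subseteq> natpermute n k"
  proof clarify
    fix xs assume "xs \<in> natpermute n k"
    then show "rotate1 xs \<in> natpermute n k" by (cases xs) (auto simp: natpermute_def)
  qed
  ultimately show ?thesis
    by (simp add: bij_betw_def endo_inj_surj natpermute_finite)
qed

text \<open>
  The weight of a list is invariant under rotation, and the first entry minus 1 is a coboundary for
  rotation. So the weighted sum of the first entries minus 1 telescopes. Averaging over all positions
  would be quicker, but it proves only the \<open>n\<close>-fold multiple of this equation.
\<close>
lemma sum_natpermute_hd_weighted:
  fixes a :: "nat \<Rightarrow> 'a::comm_ring_1"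
  assumes "n > 0"
  shows "(\<Sum>v\<in>natpermute n n. of_nat (hd v) * prod_list (map a v)) =
         (\<Sum>v\<in>natpermute n n. prod_list (map a v))"
proof -
  let ?w = "\<lambda>v. prod_list (map a v)"
  have "(\<Sum>v\<in>natpermute n n. (of_nat (hd v) - 1) * ?w v) =
        (\<Sum>v\<in>natpermute n n. of_int (max_excess v) * ?w v -
            of_int (max_excess (rotate1 v)) * ?w (rotate1 v))"
  proof (rule sum.cong[OF refl])
    fix v assume v: "v \<in> natpermute n n"
    with \<open>n > 0\<close> obtain x xs where xs: "v = x # xs"
      by (cases v) (auto simp: natpermute_def)
    have "int x - 1 = max_excess v - max_excess (rotate1 v)"
      using max_excess_rotate1[of x xs] v by (simp add: xs natpermute_def)
    from arg_cong[OF this, of "of_int :: int \<Rightarrow> 'a"]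
    have "of_nat x - 1 = (of_int (max_excess v) - of_int (max_excess (rotate1 v)) :: 'a)"
      by simp
    then have hd_eq: "of_nat (hd v) - 1 = (of_int (max_excess v) - of_int (max_excess (rotate1 v)) :: 'a)"
      by (simp add: xs)
    have w_eq: "?w (rotate1 v) = ?w v" by (simp add: xs mult.commute)
    show "(of_nat (hd v) - 1) * ?w v = of_int (max_excess v) * ?w v -
            of_int (max_excess (rotate1 v)) * ?w (rotate1 v)"
      unfolding hd_eq w_eq by (rule left_diff_distrib)
  qed
  also have "\<dots> = 0"
    using sum.reindex_bij_betw[OF bij_betw_rotate1_natpermute,
        of "\<lambda>v. of_int (max_excess v) * ?w v" n n]
    by (simp add: sum_subtractf)
  finally show ?thesis by (simp add: algebra_simps sum_subtractf)
qed

text \<open>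
  Multiplied by \<open>k + 1\<close>, this is the derivative rule for \<open>u\<^bsup>k+1\<^esup>\<close>. Without the factor, it follows by
  expanding both sides as sums over lists: \<open>X u'\<close> contributes the first entry as an extra weight.
\<close>
lemma fps_nth_power_diagonal:
  fixes u :: "'a::comm_ring_1 fps"
  shows "fps_nth (u ^ Suc k) (Suc k) = fps_nth (fps_X * fps_deriv u * u ^ k) (Suc k)"
proof -
  define b where "b = (\<lambda>j. if j = (0::nat) then fps_X * fps_deriv u else u)"
  have prod_list_eq: "prod_list (map (fps_nth u) v) = (\<Prod>j=0..k. fps_nth u (v ! j))"
    if "v \<in> natpermute n (Suc k)" for v n
    using that by (auto simp: prod.list_conv_set_nth natpermute_def atLeastLessThanSuc_atLeastAtMost
        intro!: prod.cong)
  have "fps_X * fps_deriv u * u ^ k = prod b {0..k}"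
    by (simp add: b_def prod.atLeast_Suc_atMost)
  also have "fps_nth \<dots> (Suc k) =
      (\<Sum>v\<in>natpermute (Suc k) (Suc k). \<Prod>j=0..k. fps_nth (b j) (v ! j))"
    by (simp add: fps_prod_nth)
  also have "\<dots> = (\<Sum>v\<in>natpermute (Suc k) (Suc k). of_nat (hd v) * prod_list (map (fps_nth u) v))"
  proof (rule sum.cong[OF refl])
    fix v assume v: "v \<in> natpermute (Suc k) (Suc k)"
    then obtain x xs where xs: "v = x # xs" by (cases v) (auto simp: natpermute_def)
    have "fps_nth (fps_X * fps_deriv u) x = of_nat x * fps_nth u x"
      by (cases x) auto
    then show "(\<Prod>j=0..k. fps_nth (b j) (v ! j)) = of_nat (hd v) * prod_list (map (fps_nth u) v)"
      unfolding prod_list_eq[OF v] by (simp add: b_def xs prod.atLeast_Suc_atMost mult.assoc)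
  qed
  also have "\<dots> = (\<Sum>v\<in>natpermute (Suc k) (Suc k). prod_list (map (fps_nth u) v))"
    by (rule sum_natpermute_hd_weighted) simp
  also have "\<dots> = fps_nth (u ^ Suc k) (Suc k)"
    unfolding fps_power_nth_Suc using prod_list_eq by (intro sum.cong) auto
  finally show ?thesis ..
qed

section \<open>Invariance of the residue under a change of variables\<close>

text \<open>
  For \<open>n \<ge> 2\<close> put \<open>u = X / h\<close>. Then \<open>h' / h\<^sup>n = (u\<^bsup>n-1\<^esup> - X u' u\<^bsup>n-2\<^esup>) / X\<^sup>n\<close>, and the
  residue is the difference of the two diagonal coefficients that \<open>fps_nth_power_diagonal\<close> compares.
  For \<open>n = 1\<close> the residue of the logarithmic derivative is the order of \<open>h\<close>.
\<close>
lemma residue_deriv_over_power: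
  fixes h :: "'a::field fps"
  assumes "fps_nth h 0 = 0" "fps_nth h 1 \<noteq> 0" "n \<ge> 1"
  shows "fls_residue (fps_to_fls (fps_deriv h) / fps_to_fls h ^ n) = (if n = 1 then 1 else 0)"
proof (cases "n = 1")
  case True
  have "subdegree h = 1" using assms by (intro subdegreeI) auto
  then show ?thesis
    using True fls_residue_deriv_times_inverse_eq_subdegree(1)[of "fps_to_fls h"]
    by (simp add: divide_inverse fls_deriv_fps_to_fls fls_subdegree_fls_to_fps)
next
  case False
  define k where "k = n - 2"
  with False assms have n: "n = Suc (Suc k)" by simp
  define g where "g = fps_shift 1 h"
  define u where "u = inverse g"
  have g0: "fps_nth g 0 \<noteq> 0" using assms by (simp add: g_def)
  have h: "h = fps_X * g"
    by (rule fps_ext) (use assms in \<open>auto simp: g_def fps_X_mult_nth\<close>)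
  have gu: "g * u = 1" using g0 by (simp add: u_def inverse_mult_eq_1')
  then have "fps_deriv g * u + g * fps_deriv u = 0"
    by (metis fps_deriv_mult fps_deriv_1 add.commute)
  then have dg: "fps_deriv g * u = - (g * fps_deriv u)" by (simp add: eq_neg_iff_add_eq_0)
  have "fps_deriv h * u ^ n = u ^ Suc k * (g * u) + fps_X * u ^ Suc k * (fps_deriv g * u)"
    by (simp add: h n algebra_simps)
  also have "\<dots> = u ^ Suc k * (g * u) - fps_X * fps_deriv u * u ^ k * (g * u)"
    unfolding dg by (simp add: algebra_simps)
  finally have hu: "fps_deriv h * u ^ n = u ^ Suc k - fps_X * fps_deriv u * u ^ k"
    by (simp add: gu)
  have "h * u = fps_X" using gu by (simp add: h mult.assoc)
  then have hu': "fps_to_fls h * fps_to_fls u = fls_X"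
    by (metis fls_times_fps_to_fls fps_X_to_fls)
  have [simp]: "h \<noteq> 0" using assms by auto
  have "fps_to_fls (fps_deriv h) / fps_to_fls h ^ n =
      fps_to_fls (fps_deriv h * u ^ n) / fls_X ^ n"
    unfolding hu'[symmetric] power_mult_distrib
    using gu by (auto simp: fls_times_fps_to_fls fps_to_fls_power)
  also have "fls_nth \<dots> (-1) = fps_nth (fps_deriv h * u ^ n) (Suc k)"
    by (simp add: n nat_add_distrib del: power_Suc)
  also have "\<dots> = 0" unfolding hu using fps_nth_power_diagonal[of u k] by simp
  finally show ?thesis using False by simp
qed

text \<open>
  Both sides are additive in \<open>F\<close> and vanish on power series. Induction on the order of the pole
  removes the leading term, for which the statement is \<open>residue_deriv_over_power\<close>.
\<close>
lemma residue_change_of_variables: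
  fixes h :: "'a::field fps"
  assumes "fps_nth h 0 = 0" "fps_nth h 1 \<noteq> 0"
  shows "fls_residue (fls_compose_fps F h * fps_to_fls (fps_deriv h)) = fls_residue F"
proof -
  have [simp]: "h \<noteq> 0" using assms by auto
  have "fls_residue (fls_compose_fps F h * fps_to_fls (fps_deriv h)) = fls_residue F"
    if "\<forall>i < - int m. fls_nth F i = 0" for m
    using that
  proof (induction m arbitrary: F)
    case 0
    then have F: "F = fps_to_fls (fls_regpart F)"
      by (intro fls_eqI) auto
    show ?case
      by (subst (1 2) F) (simp add: assms(1) flip: fls_times_fps_to_fls)
  next
    case (Suc m)
    define c where "c = fls_nth F (- int (Suc m))"
    define P where "P = fls_const c / fls_X ^ Suc m"
    have P_nth: "fls_nth P i = (if i = - int (Suc m) then c else 0)" for i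
      by (simp add: P_def del: power_Suc)
    have P_res: "fls_residue (fls_compose_fps P h * fps_to_fls (fps_deriv h)) = fls_residue P"
    proof -
      have P_eq: "fls_compose_fps P h * fps_to_fls (fps_deriv h) =
          fls_const c * (fps_to_fls (fps_deriv h) / fps_to_fls h ^ Suc m)"
        unfolding P_def
        by (simp add: fls_compose_fps_divide fls_compose_fps_mult fls_compose_fps_power assms(1))
      have "fls_residue (fps_to_fls (fps_deriv h) / fps_to_fls h ^ Suc m) = (if Suc m = 1 then 1 else 0)"
        by (rule residue_deriv_over_power[OF assms]) simp
      then have "fls_residue (fls_compose_fps P h * fps_to_fls (fps_deriv h)) =
          c * (if Suc m = 1 then 1 else 0)"
        by (simp only: P_eq fls_residue_fls_const_times(1))
      then show ?thesis by (simp add: P_nth)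
    qed
    have "\<forall>i < - int m. fls_nth (F - P) i = 0"
    proof safe
      fix i assume "i < - int m"
      then show "fls_nth (F - P) i = 0"
        using Suc.prems by (cases "i = - int (Suc m)") (auto simp: P_nth c_def)
    qed
    from Suc.IH[OF this] P_res show ?case
      by (simp add: fls_compose_fps_diff assms(1) algebra_simps)
  qed
  from this[of "nat (- fls_subdegree F)"] show ?thesis by simp
qed

section \<open>Conjugation and residues of displacements\<close>

text \<open>
  The remainder \<open>R(h)\<close> of the first-order Taylor expansion of \<open>h \<circ> (X - d)\<close> is of second order
  in \<open>d\<close>. Higher derivatives would come with factorials, so they are avoided: for
  \<open>h = h(0) + X g\<close> one has \<open>R(h) = (X - d) R(g) + d\<^sup>2 g'\<close>, and iterating this recursion produces
  any power of \<open>X\<close> up to the order of \<open>d\<^sup>2\<close>.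
\<close>
lemma fps_compose_first_order_remainder:
  fixes h d :: "'a::idom fps"
  assumes "fps_X ^ k dvd d" "k \<ge> 1"
  shows "fps_X ^ (2 * k) dvd fps_compose h (fps_X - d) - h + fps_deriv h * d"
proof -
  define R where "R = (\<lambda>h. fps_compose h (fps_X - d) - h + fps_deriv h * d)"
  have "fps_X dvd d"
    using assms dvd_power[of k "fps_X :: 'a fps"] by (auto intro: dvd_trans)
  then have d0: "fps_nth d 0 = 0" and Xd: "fps_X dvd fps_X - d" by auto
  have d2: "fps_X ^ (2 * k) dvd d ^ 2"
    using dvd_power_same[OF assms(1), of 2] by (simp add: mult.commute flip: power_mult)
  have "fps_X ^ j dvd R h" if "j \<le> 2 * k" for j
    using that
  proof (induction j arbitrary: h)
    case (Suc j)
    define g where "g = fps_shift 1 h"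
    have h: "h = fps_const (fps_nth h 0) + fps_X * g"
      by (rule fps_ext) (auto simp: g_def)
    have "R h = (fps_X - d) * R g + d ^ 2 * fps_deriv g"
      by (subst h, subst R_def)
        (simp add: R_def fps_compose_add_distrib fps_compose_mult_distrib d0 power2_eq_square algebra_simps)
    moreover have "fps_X ^ Suc j dvd (fps_X - d) * R g"
      using mult_dvd_mono[OF Xd Suc.IH[of g]] Suc.prems by simp
    moreover have "fps_X ^ Suc j dvd d ^ 2 * fps_deriv g"
      using le_imp_power_dvd[OF Suc.prems, of fps_X] d2 by (auto intro: dvd_trans)
    ultimately show ?case by simp
  qed auto
  from this[of "2 * k"] show ?thesis by (simp add: R_def)
qed

text \<open>
  The exponent \<open>q - l\<close> is a multiple of the characteristic \<open>p\<close>. If \<open>p = 0\<close>, the exponent is 0 and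
  the difference vanishes. If \<open>p\<close> is prime and \<open>h = c X + X\<^sup>2 r\<close>, then \<open>h\<^sup>p = c\<^sup>p X\<^sup>p + X\<^bsup>2p\<^esup> r\<^sup>p\<close>,
  so the relative error is divisible by \<open>X\<^sup>p\<close>. The error thus has order at least \<open>q - l + p\<close>, which
  exceeds \<open>q\<close> because \<open>l\<close> is the remainder of \<open>q\<close> modulo \<open>p\<close>.
\<close>
lemma power_diff_linear_part_dvd:
  fixes h :: "'a::field fps" and q l :: nat
  assumes h0: "fps_nth h 0 = 0" and l: "l = (LEAST n. of_nat n = (of_nat q :: 'a))"
  shows "fps_X ^ Suc q dvd h ^ (q - l) - fps_const (fps_nth h 1 ^ (q - l)) * fps_X ^ (q - l)"
proof -
  define p where "p = CHAR('a)"
  have lq: "of_nat l = (of_nat q :: 'a)"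
    unfolding l by (rule LeastI[of "\<lambda>n. of_nat n = (of_nat q :: 'a)" q]) simp
  have "l \<le> q" unfolding l by (rule Least_le) simp
  have "of_nat (q - l) = (0 :: 'a)" using lq \<open>l \<le> q\<close> by (simp add: of_nat_diff)
  then obtain k where k: "q - l = p * k"
    by (auto simp: of_nat_eq_0_iff_char_dvd p_def)
  show ?thesis
  proof (cases "p = 0")
    case False
    then have "prime p" using prime_CHAR_semidom[where ?'a = 'a] by (simp add: p_def)
    have "of_nat (q mod p) = (of_nat q :: 'a)"
      by (simp add: of_nat_eq_iff_cong_CHAR p_def)
    then have "l \<le> q mod p" unfolding l by (rule Least_le)
    with False have "l < p" by (meson le_less_trans mod_less_divisor not_gr_zero)
    define c where "c = fps_nth h 1"
    obtain r where h: "h = fps_const c * fps_X + fps_X ^ 2 * r"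
    proof
      show "h = fps_const c * fps_X + fps_X ^ 2 * fps_shift 2 h"
      proof (rule fps_ext)
        fix n show "fps_nth h n = fps_nth (fps_const c * fps_X + fps_X ^ 2 * fps_shift 2 h) n"
          using h0 by (cases n; cases "n - 1") (auto simp: c_def fps_X_power_mult_nth)
      qed
    qed
    have "h ^ p = (fps_const c * fps_X) ^ p + (fps_X ^ 2 * r) ^ p"
      unfolding h by (rule freshmans_dream) (use \<open>prime p\<close> in \<open>simp_all add: p_def\<close>)
    also have "\<dots> = fps_X ^ p * (fps_const (c ^ p) + fps_X ^ p * r ^ p)"
      by (simp only: power_mult_distrib power2_eq_square fps_const_power distrib_left mult_ac)
    finally have hp: "h ^ p = fps_X ^ p * (fps_const (c ^ p) + fps_X ^ p * r ^ p)" .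
    have "fps_X ^ p dvd (fps_const (c ^ p) + fps_X ^ p * r ^ p) ^ k - fps_const (c ^ p) ^ k"
      by (subst power_diff_sumr2) simp
    then have "fps_X ^ (p * k) * fps_X ^ p dvd
        fps_X ^ (p * k) * ((fps_const (c ^ p) + fps_X ^ p * r ^ p) ^ k - fps_const (c ^ p) ^ k)"
      by (rule mult_dvd_mono[OF dvd_refl])
    also have "\<dots> = h ^ (q - l) - fps_const (c ^ (q - l)) * fps_X ^ (q - l)"
      unfolding k power_mult hp power_mult_distrib fps_const_power by (simp add: algebra_simps)
    finally have "fps_X ^ (p * k + p) dvd h ^ (q - l) - fps_const (c ^ (q - l)) * fps_X ^ (q - l)"
      by (simp only: power_add)
    moreover have "Suc q \<le> p * k + p" using k \<open>l < p\<close> by linarith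
    ultimately show ?thesis
      unfolding c_def by (meson dvd_trans le_imp_power_dvd)
  qed (use k in simp)
qed

lemma residue_cong_mod_power:
  fixes A B D :: "'a::field fps"
  assumes "D \<noteq> 0" "fps_X ^ subdegree D dvd A - B"
  shows "fls_residue (fps_to_fls A / fps_to_fls D) = fls_residue (fps_to_fls B / fps_to_fls D)"
proof -
  have "D dvd fps_X ^ subdegree D"
    using assms(1) by (simp add: fps_dvd_iff)
  then have "D dvd A - B" using assms(2) by (rule dvd_trans)
  then obtain E where "A - B = D * E" by (elim dvdE)
  then have "A = B + D * E" by (simp add: algebra_simps)
  then have "fps_to_fls A / fps_to_fls D = fps_to_fls B / fps_to_fls D + fps_to_fls E"
    using assms(1) by (simp add: add_divide_distrib fls_times_fps_to_fls)
  then show ?thesis by simp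
qed

text \<open>
  Here \<open>e\<close> is the displacement of the conjugate series, and the hypothesis on \<open>D \<circ> h\<close> is the
  conjugacy relation. To first order it reads \<open>D \<circ> h = h' e\<close>, with an error divisible by \<open>e\<^sup>2\<close>.
  As \<open>h'\<close> is a unit, \<open>D \<circ> h\<close> and \<open>e\<close> have the same order; so the product of the two denominators
  has the order of \<open>e\<^sup>2\<close>, and the error only changes the quotient by a power series.
\<close>
lemma residue_conjugate_displacement:
  fixes h A D e :: "'a::field fps"
  assumes h: "fps_nth h 0 = 0" "fps_nth h 1 \<noteq> 0"
    and e: "fps_nth e 0 = 0" and D: "D \<noteq> 0"
    and conj: "fps_compose D h = h - fps_compose h (fps_X - e)"
  shows "subdegree e = subdegree D"
    and "fls_residue (fps_to_fls A / fps_to_fls e) =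
         fls_residue (fps_to_fls (A * fps_deriv h) / fps_to_fls (fps_compose D h))"
proof -
  have [simp]: "h \<noteq> 0" using h by auto
  have sub_h: "subdegree h = 1" using h by (intro subdegreeI) auto
  have Dh: "fps_compose D h \<noteq> 0" using D h by (simp add: fps_compose_eq_0_iff)
  have e_nz: "e \<noteq> 0" using Dh conj by auto
  define k where "k = subdegree e"
  have k: "k \<ge> 1" using e e_nz by (metis One_nat_def Suc_leI k_def not_gr_zero nth_subdegree_nonzero)
  have dh0: "fps_nth (fps_deriv h) 0 \<noteq> 0" using h by simp
  then have [simp]: "fps_deriv h \<noteq> 0" "subdegree (fps_deriv h) = 0" by (auto simp del: fps_deriv_nth)
  have "fps_X ^ k dvd e" using e_nz by (simp add: k_def fps_dvd_iff)
  from fps_compose_first_order_remainder[OF this k, of h]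
  have rem: "fps_X ^ (2 * k) dvd fps_deriv h * e - fps_compose D h"
    by (simp add: conj algebra_simps)
  then obtain E where E: "fps_deriv h * e - fps_compose D h = fps_X ^ (2 * k) * E" by (elim dvdE)
  have sub: "subdegree (fps_compose D h) = k"
  proof (rule subdegreeI)
    have eq: "fps_compose D h = fps_deriv h * e - fps_X ^ (2 * k) * E"
      using E by (simp add: algebra_simps)
    have "fps_nth (fps_deriv h * e) k = fps_nth (fps_deriv h) 0 * fps_nth e k"
      using nth_subdegree_mult[of "fps_deriv h" e] by (simp add: k_def)
    moreover have "fps_nth e k \<noteq> 0" using e_nz by (simp add: k_def)
    ultimately show "fps_nth (fps_compose D h) k \<noteq> 0"
      using k dh0 unfolding eq by (simp add: fps_X_power_mult_nth)
    fix i assume "i < k"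
    then show "fps_nth (fps_compose D h) i = 0"
      unfolding eq using k by (simp add: fps_X_power_mult_nth k_def fps_mult_nth_outside_subdegrees)
  qed
  then show "subdegree e = subdegree D" using h sub_h by (simp add: k_def)
  let ?P = "e * fps_compose D h"
  have "subdegree ?P = 2 * k" using e_nz Dh sub by (simp add: k_def)
  moreover have "fps_X ^ (2 * k) dvd A * fps_deriv h * e - A * fps_compose D h"
    using dvd_mult[OF rem, of A] by (simp add: algebra_simps)
  ultimately have "fls_residue (fps_to_fls (A * fps_deriv h * e) / fps_to_fls ?P) =
      fls_residue (fps_to_fls (A * fps_compose D h) / fps_to_fls ?P)"
    using e_nz Dh by (intro residue_cong_mod_power) auto
  then show "fls_residue (fps_to_fls A / fps_to_fls e) =
         fls_residue (fps_to_fls (A * fps_deriv h) / fps_to_fls (fps_compose D h))"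
    using e_nz Dh by (simp add: fls_times_fps_to_fls)
qed

section \<open>The transformation law of the index\<close>

lemma fixpoint_mult_eq_iff:
  fixes f :: "'a::field fps"
  assumes "q \<ge> 1"
  shows "fps_fixpoint_mult f - 1 = enat q \<longleftrightarrow> subdegree (fps_X - f) = Suc q"
proof -
  have "subdegree (f - fps_X) = subdegree (fps_X - f)"
    by (metis minus_diff_eq subdegree_uminus)
  then show ?thesis
    using assms by (auto simp: fps_fixpoint_mult_def one_enat_def)
qed

lemma second_residue_index_eq:
  fixes f :: "'a::field fps"
  assumes "q \<ge> 1" "subdegree (fps_X - f) = Suc q" "l = (LEAST n. of_nat n = (of_nat q :: 'a))"
  shows "second_residue_index f =
    fls_residue (fps_to_fls (fps_X ^ (q - l)) / fps_to_fls (fps_X - f))"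
proof -
  have "fps_fixpoint_mult f - 1 = enat q"
    using assms by (simp add: fixpoint_mult_eq_iff)
  then show ?thesis
    by (simp add: second_residue_index_def assms(3) Let_def fps_to_fls_power)
qed

theorem proposition2p5:
  fixes f h :: "'a::field fps" and q l :: nat
  assumes "fps_nth f 0 = 0"
    and "fps_fixpoint_mult f - 1 = enat q" and "1 \<le> q"
    and "l = (LEAST n. of_nat n = (of_nat q :: 'a))"
    and "fps_nth h 0 = 0" and "fps_nth (fps_deriv h) 0 \<noteq> 0"
  shows "second_residue_index (fps_compose (fps_compose (fps_inv h) f) h) =
         (fps_nth (fps_deriv h) 0) powi (int l - int q) * second_residue_index f"
proof -
  define c where "c = fps_nth (fps_deriv h) 0"
  have c: "c = fps_nth h 1" by (simp add: c_def)
  have h: "fps_nth h 0 = 0" "fps_nth h 1 \<noteq> 0" using assms by auto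
  have [simp]: "h \<noteq> 0" using h by auto
  define D where "D = fps_X - f"
  define fh where "fh = fps_compose (fps_compose (fps_inv h) f) h"
  define e where "e = fps_X - fh"
  define N where "N = q - l"
  have sub_D: "subdegree D = Suc q"
    using assms(2,3) by (simp add: D_def fixpoint_mult_eq_iff)
  then have D: "D \<noteq> 0" by auto
  have inv0: "fps_nth (fps_inv h) 0 = 0" by (simp add: fps_inv_def)
  have e0: "fps_nth e 0 = 0" by (simp add: e_def fh_def inv0)
  have "fps_compose h fh = fps_compose (fps_compose (fps_compose h (fps_inv h)) f) h"
    unfolding fh_def by (simp add: fps_compose_assoc assms(1) h(1) inv0)
  also have "\<dots> = fps_compose f h"
    using h assms(1) by (simp add: fps_inv_right)
  finally have conj: "fps_compose D h = h - fps_compose h (fps_X - e)"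
    by (simp add: D_def e_def fps_compose_sub_distrib h(1))
  note disp = residue_conjugate_displacement[OF h e0 D conj]
  have "subdegree h = 1" using h by (intro subdegreeI) auto
  then have sub_Dh: "subdegree (fps_compose D h) = Suc q" by (simp add: h(1) sub_D)
  then have Dh: "fps_compose D h \<noteq> 0" by auto

  let ?hN = "h ^ N * fps_deriv h"
  let ?XN = "fps_X ^ N * fps_deriv h"
  have "second_residue_index f = fls_residue (fps_to_fls (fps_X ^ N) / fps_to_fls D)"
    unfolding D_def N_def by (rule second_residue_index_eq) (use assms sub_D D_def in auto)
  also have "\<dots> = fls_residue (fps_to_fls ?hN / fps_to_fls (fps_compose D h))"
    by (subst residue_change_of_variables[OF h, symmetric])
      (simp add: fls_compose_fps_divide h(1) fps_to_fls_power fls_compose_fps_power fls_times_fps_to_fls)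
  also have "\<dots> = fls_residue (fps_to_fls (fps_const (c ^ N) * ?XN) / fps_to_fls (fps_compose D h))"
  proof (rule residue_cong_mod_power[OF Dh])
    have "fps_X ^ Suc q dvd (h ^ N - fps_const (c ^ N) * fps_X ^ N) * fps_deriv h"
      unfolding c N_def using power_diff_linear_part_dvd[OF h(1) assms(4)] by (rule dvd_mult2)
    then show "fps_X ^ subdegree (fps_compose D h) dvd ?hN - fps_const (c ^ N) * ?XN"
      unfolding sub_Dh by (simp add: algebra_simps)
  qed
  also have "\<dots> = c ^ N * fls_residue (fps_to_fls ?XN / fps_to_fls (fps_compose D h))"
    by (simp add: fls_times_fps_to_fls fls_residue_fls_const_times
        del: fls_residue_def times_divide_eq_right flip: times_divide_eq_right)
  also have "fls_residue (fps_to_fls ?XN / fps_to_fls (fps_compose D h)) =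
      fls_residue (fps_to_fls (fps_X ^ N) / fps_to_fls e)"
    by (rule disp(2)[symmetric])
  also have "\<dots> = second_residue_index fh"
    unfolding e_def N_def
    by (rule second_residue_index_eq[symmetric]) (use assms disp(1) sub_D e_def in auto)
  finally have "second_residue_index f = c ^ N * second_residue_index fh" .
  moreover have "l \<le> q" unfolding assms(4) by (rule Least_le) simp
  then have "int l - int q = - int N" by (simp add: N_def)
  ultimately show ?thesis
    using assms(6) by (simp add: fh_def c_def power_int_minus)
qed

end
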